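(* Let $n$ be a non-negative integer. Let $q,a,x,c$ be complex numbers (with fixed choices of square roots $\sqrt c$, $\sqrt q$ and $\sqrt{cq}=\sqrt c\sqrt q$) for which $q,a,x\neq 0$ and no denominator occurring below vanishes (equivalently, the identity is one of rational functions in indeterminates $q,a,x,c$). Then $$ {}_{3}\phi_{2}\left[\begin{array}{c} q^{-n}, a, x\\ c,\, 0\end{array};q,q\right] \;{}_{3}\phi_{2}\left[\begin{array}{c} q^{-n}, a, c/x\\ c,\, 0\end{array};q,q\right] =a^n\, {}_{6}\phi_{5}\left[\begin{array}{c} q^{-n}, cq^{n}, a, c/a, x, c/x\\ c,\sqrt{c}, -\sqrt{c}, \sqrt{cq}, -\sqrt{cq}\end{array};q,q\right]. $$
   Context: The $q$-shifted factorial is $(a;q)_0=1$ and $(a;q)_k=(1-a)(1-aq)\cdots(1-aq^{k-1})$ for $k\geq 1$. The basic hypergeometric series is $$ {}_{r}\phi_{s}\left[\begin{array}{c} a_1,\ldots,a_{r}\\ b_1,\ldots,b_{s}\end{array};q, z\right] =\sum_{k=0}^{\infty}\frac{(a_1;q)_k\cdots (a_r;q)_k}{(q;q)_k (b_1;q)_k \cdots (b_s;q)_k}\left((-1)^k q^{k(k-1)/2}\right)^{1+s-r} z^k . $$ When one of the upper parameters is $q^{-n}$ with $n$ a non-negative integer, the series terminates: $(q^{-n};q)_k=0$ for $k>n$, so the sum is the finite sum over $0\le k\le n$. Note that $(0;q)_k=1$. *)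

theory Defs
  imports Complex_Main
begin

definition qpoch :: "complex \<Rightarrow> complex \<Rightarrow> nat \<Rightarrow> complex" where
  "qpoch a q k = (\<Prod>i<k. 1 - a * q ^ i)"

definition basic_hyp_term ::
    "complex list \<Rightarrow> complex list \<Rightarrow> complex \<Rightarrow> complex \<Rightarrow> nat \<Rightarrow> complex" where
  "basic_hyp_term as bs q z k =
     (\<Prod>a\<leftarrow>as. qpoch a q k) / (qpoch q q k * (\<Prod>b\<leftarrow>bs. qpoch b q k))
       * ((-1) ^ k * q ^ (k * (k - 1) div 2)) powi (1 + int (length bs) - int (length as))
       * z ^ k"

(* The exponent 1 + s - r of the sign/quadratic factor is an integer, possibly negative,
   hence powi. *)
definition basic_hyp ::
    "complex list \<Rightarrow> complex list \<Rightarrow> complex \<Rightarrow> complex \<Rightarrow> complex" where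
  "basic_hyp as bs q z = (\<Sum>k. basic_hyp_term as bs q z k)"

(* An upper parameter q^(-n) makes the series terminate.  Since division by zero yields zero,
   the terms with k > n vanish even if a lower parameter produces a zero denominator there,
   so the value is always the finite sum over k \<le> n. *)
lemma basic_hyp_terminating:
  assumes "q \<noteq> 0" and "q powi (- int n) \<in> set as"
  shows "basic_hyp as bs q z = (\<Sum>k\<le>n. basic_hyp_term as bs q z k)"
proof -
  have "basic_hyp_term as bs q z k = 0" if "k \<notin> {..n}" for k
  proof -
    have "1 - q powi (- int n) * q ^ n = 0"
      using assms(1) by (simp add: power_int_minus)
    moreover have "n < k"
      using that by simp
    ultimately have "qpoch (q powi (- int n)) q k = 0"
      unfolding qpoch_def by (intro prod_zero) auto
    then have "(\<Prod>a\<leftarrow>as. qpoch a q k) = 0"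
      using assms(2) by (force simp: prod_list_zero_iff)
    then show ?thesis
      by (simp add: basic_hyp_term_def)
  qed
  then show ?thesis
    unfolding basic_hyp_def by (intro suminf_finite) auto
qed

end

theory Submission
  imports Defs
begin

text \<open>
Put \<open>y = c / x\<close> and write \<open>\<phi>\<^sub>n(x)\<close> for the terminating \<open>3\<phi>2\<close> with upper parameters
\<open>q\<^sup>-\<^sup>n, a, x\<close>. As a function of \<open>n\<close> it is, up to normalisation, an Al-Salam--Chihara polynomial,
so it satisfies a three-term recurrence
  \<open>(1 - c q\<^sup>n) \<phi>\<^sub>n\<^sub>+\<^sub>1(x) = (u + v x) \<phi>\<^sub>n(x) - a x (1 - q\<^sup>n) \<phi>\<^sub>n\<^sub>-\<^sub>1(x)\<close>
with \<open>u = a - c q\<^sup>n\<close> and \<open>v = 1 - a q\<^sup>n\<close> (lemma \<open>phi_three_term\<close>), in which \<open>x\<close> enters only linearly.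

The theorem says that \<open>\<phi>\<^sub>n(x) \<phi>\<^sub>n(y)\<close> has an explicit expansion in the products
\<open>e\<^sub>k = (x;q)\<^sub>k (y;q)\<^sub>k\<close>, which form a basis of the polynomials in \<open>x + y\<close>. An induction on \<open>n\<close> needs
also the products \<open>\<phi>\<^sub>n\<^sub>+\<^sub>1(x) \<phi>\<^sub>n(y)\<close>, which are not symmetric in \<open>x\<close> and \<open>y\<close>. The idea that makes the
proof work is that these have an equally explicit expansion, with the summands \<open>e\<^sub>k\<close> multiplied by a
polynomial of degree one in \<open>x\<close> (\<open>mixed_sum\<close>). Granted both expansions for all products
up to \<open>\<phi>\<^sub>n(x) \<phi>\<^sub>n(y)\<close>, two facts remain.

First, multiplying the recurrence for \<open>x\<close> by \<open>\<phi>\<^sub>n(y)\<close> gives the next mixed product. As \<open>x y = c\<close> is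
a constant, the multiplication by \<open>x\<close> of a term linear in \<open>y\<close> is again linear in \<open>x\<close>,
and the corresponding identity of sums holds term by term (\<open>mixed_sum_recurrence\<close>).

Secondly, moving \<open>(u + v x) \<phi>\<^sub>n(x)\<close> to the left in the recurrence and multiplying with the same
equation for \<open>y\<close> expresses \<open>\<phi>\<^sub>n\<^sub>+\<^sub>1(x) \<phi>\<^sub>n\<^sub>+\<^sub>1(y)\<close> by products that are already known. The right-hand side
becomes \<open>a\<^sup>2 c (1 - q\<^sup>n)\<^sup>2 \<phi>\<^sub>n\<^sub>-\<^sub>1(x) \<phi>\<^sub>n\<^sub>-\<^sub>1(y)\<close>, again because of \<open>x y = c\<close>. The corresponding
identity of sums does not hold term by term, but it telescopes (\<open>diag_sum_recurrence\<close>).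

Finally, the four square-root parameters of the \<open>6\<phi>5\<close> combine to \<open>(c;q)\<^sub>2\<^sub>k\<close> (\<open>qpoch_pm_sqrt\<close>).
\<close>

section \<open>Shifted factorials and telescoping sums\<close>

lemma qpoch_0 [simp]: "qpoch a q 0 = 1"
  and qpoch_Suc: "qpoch a q (Suc k) = qpoch a q k * (1 - a * q ^ k)"
  by (simp_all add: qpoch_def)

lemma qpoch_shift: "(1 - a) * qpoch (a * q) q k = qpoch a q k * (1 - a * q ^ k)"
proof (induction k)
  case (Suc k)
  have "(1 - a) * qpoch (a * q) q (Suc k) = ((1 - a) * qpoch (a * q) q k) * (1 - a * q ^ Suc k)"
    by (simp add: qpoch_Suc mult.assoc)
  then show ?case by (simp only: Suc.IH qpoch_Suc)
qed simp

lemma qpoch_negpow_eq_0: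
  assumes "q \<noteq> 0" "n < k" shows "qpoch (1 / q ^ n) q k = 0"
  unfolding qpoch_def using assms by (intro prod_zero) auto

text \<open>
Pairing \<open>(1 - s q\<^sup>k) (1 + s q\<^sup>k) = 1 - c q\<^sup>2\<^sup>k\<close> produces the factors of \<open>(c;q)\<^sub>2\<^sub>k\<close> with even exponent,
and the same with \<open>s r\<close> those with odd exponent.
\<close>
lemma qpoch_pm_sqrt:
  assumes "s\<^sup>2 = c" "r\<^sup>2 = q"
  shows "qpoch s q k * qpoch (- s) q k * qpoch (s * r) q k * qpoch (- (s * r)) q k = qpoch c q (2 * k)"
proof (induction k)
  case (Suc k)
  have p: "q ^ (2 * k) = q ^ k * q ^ k" by (simp add: mult_2 power_add)
  have "(1 - s * q ^ k) * (1 - - s * q ^ k) * (1 - s * r * q ^ k) * (1 - - (s * r) * q ^ k)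
     = (1 - c * (q ^ k * q ^ k)) * (1 - c * (q * (q ^ k * q ^ k)))"
    unfolding assms[symmetric] by algebra
  then have "(qpoch s q k * qpoch (- s) q k * qpoch (s * r) q k * qpoch (- (s * r)) q k) *
      ((1 - s * q ^ k) * (1 - - s * q ^ k) * (1 - s * r * q ^ k) * (1 - - (s * r) * q ^ k))
     = qpoch c q (2 * k) * ((1 - c * (q ^ k * q ^ k)) * (1 - c * (q * (q ^ k * q ^ k))))"
    by (simp only: Suc.IH)
  moreover have "qpoch c q (2 * Suc k) = qpoch c q (2 * k)
      * ((1 - c * (q ^ k * q ^ k)) * (1 - c * (q * (q ^ k * q ^ k))))"
    by (simp add: qpoch_Suc p mult.assoc)
  ultimately show ?case by (simp only: qpoch_Suc mult_ac)
qed simp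

text \<open>
How identities between expansions in shifted factorials are verified: a multiplication by the variable
turns the basis element \<open>y k\<close> into a combination of \<open>y k\<close> and \<open>y (Suc k)\<close>, and the
resulting coefficients cancel after a shift of the index.
\<close>
lemma sum_telescope_zero:
  fixes T V y :: "nat \<Rightarrow> complex"
  assumes "T 0 = 0" and "V N = 0" and "\<And>k. k < N \<Longrightarrow> T (Suc k) = - V k"
  shows "(\<Sum>k\<le>N. T k * y k + V k * y (Suc k)) = 0"
proof -
  have "(\<Sum>k\<le>m. T k * y k + V k * y (Suc k)) = V m * y (Suc m)" if "m \<le> N" for m
    using that by (induction m) (simp_all add: assms)
  from this[of N] show ?thesis by (simp add: assms)
qed

section \<open>The terminating series and its three-term recurrence\<close>

text \<open>
The bound \<open>N\<close> is the largest degree in play. It is needed because \<open>q\<close> may be a root of unity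
of order greater than \<open>N\<close>, or \<open>c\<close> a negative power of \<open>q\<close> of large exponent; then the denominators
are nonzero only up to \<open>N\<close>. The exponents of \<open>q\<close> in
\<open>c_pow\<close> go up to \<open>2 * N - 1\<close> since \<open>(c;q)\<^sub>2\<^sub>k\<close> is a denominator of the \<open>6\<phi>5\<close>.
\<close>
locale phi_product =
  fixes q a c :: complex and N :: nat
  assumes q0: "q \<noteq> 0" and a0: "a \<noteq> 0"
    and q_pow: "\<And>k. k < N \<Longrightarrow> q ^ Suc k \<noteq> 1"
    and c_pow: "\<And>k. k < 2 * N \<Longrightarrow> c * q ^ k \<noteq> 1"
begin

definition phi_coeff :: "nat \<Rightarrow> nat \<Rightarrow> complex" where
  "phi_coeff n k = qpoch (1 / q ^ n) q k * qpoch a q k * q ^ k / (qpoch q q k * qpoch c q k)"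

definition phi :: "nat \<Rightarrow> complex \<Rightarrow> complex" where
  "phi n x = (\<Sum>k\<le>n. phi_coeff n k * qpoch x q k)"

text \<open>
The part of the coefficients of both product expansions that does not depend on \<open>n\<close>, so that their
ratios for neighbouring \<open>n\<close> come from two shifted factorials only.
\<close>
definition common_part :: "nat \<Rightarrow> complex" where
  "common_part k = qpoch a q k * qpoch (c / a) q k / (qpoch q q k * qpoch c q k * qpoch c q (2 * k))"

text \<open>
The coefficients of the \<open>6\<phi>5\<close>, including the factor \<open>a\<^sup>n\<close>.
\<close>
definition diag_coeff :: "nat \<Rightarrow> nat \<Rightarrow> complex" where
  "diag_coeff n k = a ^ n * qpoch (1 / q ^ n) q k * qpoch (c * q ^ n) q k * common_part k * q ^ k"

text \<open>
The coefficients for \<open>\<phi>\<^sub>n\<^sub>+\<^sub>1(x) \<phi>\<^sub>n(y)\<close>. They differ from the previous ones by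
\<open>c q\<^sup>n\<^sup>+\<^sup>1\<close> in place of \<open>c q\<^sup>n\<close> and by the missing power of \<open>q\<close>; hence they are simple multiples both of
\<open>diag_coeff n k\<close> and of \<open>diag_coeff (Suc n) k\<close>.
\<close>
definition mixed_coeff :: "nat \<Rightarrow> nat \<Rightarrow> complex" where
  "mixed_coeff n k = a ^ n * qpoch (1 / q ^ n) q k * qpoch (c * q ^ Suc n) q k * common_part k"

lemma coeff_eq_0: "n < k \<Longrightarrow> phi_coeff n k = 0" "n < k \<Longrightarrow> diag_coeff n k = 0" "n < k \<Longrightarrow> mixed_coeff n k = 0"
  using q0 by (simp_all add: phi_coeff_def diag_coeff_def mixed_coeff_def qpoch_negpow_eq_0)

text \<open>
Written without division because \<open>q\<^sup>k - q\<^sup>n\<^sup>+\<^sup>1\<close> vanishes at \<open>k = n + 1\<close>, where the identity is used too.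
\<close>
lemma qpoch_negpow_Suc_n:
  "(q ^ k - q ^ Suc n) * qpoch (1 / q ^ Suc n) q k = (1 - q ^ Suc n) * qpoch (1 / q ^ n) q k"
  using qpoch_shift[of "1 / q ^ Suc n" q k] q0 by (simp add: field_simps)

lemma phi_coeff_0 [simp]: "phi_coeff n 0 = 1"
  and diag_coeff_0 [simp]: "diag_coeff n 0 = a ^ n"
  and mixed_coeff_0 [simp]: "mixed_coeff n 0 = a ^ n"
  by (simp_all add: phi_coeff_def diag_coeff_def mixed_coeff_def common_part_def)

lemma phi_coeff_Suc_n: "(1 - q ^ Suc n) * phi_coeff n k = (q ^ k - q ^ Suc n) * phi_coeff (Suc n) k"
  using arg_cong[OF qpoch_negpow_Suc_n[of k n], of "\<lambda>t. t * qpoch a q k * q ^ k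
      / (qpoch q q k * qpoch c q k)"]
  unfolding phi_coeff_def by (simp only: times_divide_eq_right mult_ac)

lemma one_minus_pow_nonzero: "k < N \<Longrightarrow> 1 - q * q ^ k \<noteq> 0" "k < 2 * N \<Longrightarrow> 1 - c * q ^ k \<noteq> 0"
  using q_pow c_pow by fastforce+

lemma qpoch_negpow_Suc_Suc: "qpoch (1 / q ^ Suc n) q (Suc k) = (1 - 1 / q ^ Suc n) * qpoch (1 / q ^ n) q k"
  using qpoch_shift[of "1 / q ^ Suc n" q k] q0 by (simp add: qpoch_Suc)

lemma phi_coeff_Suc:
  "phi_coeff n (Suc k) = phi_coeff n k * (1 - q ^ k / q ^ n) * (1 - a * q ^ k) * q
      / ((1 - q * q ^ k) * (1 - c * q ^ k))"
  by (simp add: phi_coeff_def qpoch_Suc) (simp add: mult_ac)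

lemma phi_coeff_Suc_Suc:
  "phi_coeff (Suc n) (Suc k) = phi_coeff n k * (1 - 1 / q ^ Suc n) * (1 - a * q ^ k) * q
      / ((1 - q * q ^ k) * (1 - c * q ^ k))"
  unfolding phi_coeff_def qpoch_negpow_Suc_Suc qpoch_Suc[of a] qpoch_Suc[of c] qpoch_Suc[of q]
  by (simp add: mult_ac)

text \<open>
A contiguous relation of first order: the next polynomial is obtained from the coefficients of the present
one. The two sides differ by a telescoping sum. It gives the three-term recurrence because the numerator
\<open>1 - c q\<^sup>n q\<^sup>k - (1 - a q\<^sup>k) (1 - x q\<^sup>k)\<close> is a multiple of \<open>q\<^sup>k\<close>.
\<close>
lemma phi_Suc:
  assumes "n < N"
  shows "(1 - c * q ^ n) * phi (Suc n) x =
    (\<Sum>k\<le>n. phi_coeff n k * (1 - c * q ^ n * q ^ k - (1 - a * q ^ k) * (1 - x * q ^ k)) / q ^ k * qpoch x q k)"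
proof -
  define T where "T k = (1 - c * q ^ n) * phi_coeff (Suc n) k - phi_coeff n k * (1 - c * q ^ n * q ^ k)
      / q ^ k" for k
  define V where "V k = phi_coeff n k * (1 - a * q ^ k) / q ^ k" for k
  have "(\<Sum>k\<le>Suc n. T k * qpoch x q k + V k * qpoch x q (Suc k)) = 0"
  proof (rule sum_telescope_zero)
    show "T 0 = 0" by (simp add: T_def)
    show "V (Suc n) = 0" by (simp add: V_def coeff_eq_0)
    fix k assume k: "k < Suc n"
    then have kN: "k < N" using assms by simp
    have alg: "(1 - c * Q) * (b * (1 - 1 / (q * Q)) * aK * q / ((1 - q * K) * (1 - c * K)))
       - (b * (1 - K / Q) * aK * q / ((1 - q * K) * (1 - c * K))) * (1 - c * Q * (q * K)) / (q * K)
       = - (b * aK / K)" if "Q \<noteq> 0" "K \<noteq> 0" "1 - q * K \<noteq> 0" "1 - c * K \<noteq> 0" for Q K b aK :: complex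
      using that q0 by (simp add: divide_simps) algebra
    show "T (Suc k) = - V k"
      unfolding T_def V_def phi_coeff_Suc_Suc phi_coeff_Suc[of n]
          using alg[of "q ^ n" "q ^ k" "phi_coeff n k" "1 - a
          * q ^ k"] q0 one_minus_pow_nonzero(1)[OF kN] one_minus_pow_nonzero(2)[of k] kN
      by simp
  qed
  moreover have "T k * qpoch x q k + V k * qpoch x q (Suc k)
      = (1 - c * q ^ n) * (phi_coeff (Suc n) k * qpoch x q k)
     - phi_coeff n k * (1 - c * q ^ n * q ^ k - (1 - a * q ^ k) * (1 - x * q ^ k)) / q ^ k
         * qpoch x q k" for k
    using q0 by (simp add: T_def V_def qpoch_Suc field_simps)
  ultimately have "(1 - c * q ^ n) * phi (Suc n) x
     = (\<Sum>k\<le>Suc n. phi_coeff n k * (1 - c * q ^ n * q ^ k - (1 - a * q ^ k) * (1 - x * q ^ k)) / q ^ k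
         * qpoch x q k)"
    by (simp only: phi_def sum_subtractf sum_distrib_left) simp
  then show ?thesis by (simp add: coeff_eq_0)
qed

text \<open>
After division by \<open>q\<^sup>k\<close>, the factor in \<open>phi_Suc\<close> is \<open>u + v x - a x (q\<^sup>k - q\<^sup>n)\<close>, and
multiplication by \<open>q\<^sup>k - q\<^sup>n\<close> lowers the degree \<open>n\<close> by \<open>phi_coeff_Suc_n\<close>.
\<close>
lemma phi_three_term:
  assumes "Suc n < N"
  shows "(1 - c * q ^ Suc n) * phi (Suc (Suc n)) x =
    (a - c * q ^ Suc n + (1 - a * q ^ Suc n) * x) * phi (Suc n) x - a * x * (1 - q ^ Suc n) * phi n x"
proof -
  have ext: "phi n x = (\<Sum>k\<le>Suc n. phi_coeff n k * qpoch x q k)" by (simp add: phi_def coeff_eq_0)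
  have "(1 - c * P * K - (1 - a * K) * (1 - x * K)) / K * b * y
     = (a - c * P + (1 - a * P) * x) * (b * y) - a * x * (((K - P) * b) * y)"
         if "K \<noteq> 0" for P K b y :: complex
    using that by (simp add: field_simps)
  from this[of "q ^ k" "q ^ Suc n" "phi_coeff (Suc n) k" "qpoch x q k" for k]
  have *: "phi_coeff (Suc n) k * (1 - c * q ^ Suc n * q ^ k - (1 - a * q ^ k) * (1 - x * q ^ k)) / q ^ k
      * qpoch x q k
     = (a - c * q ^ Suc n + (1 - a * q ^ Suc n) * x) * (phi_coeff (Suc n) k * qpoch x q k)
       - a * x * (1 - q ^ Suc n) * (phi_coeff n k * qpoch x q k)" for k
    using q0 by (simp only: phi_coeff_Suc_n[symmetric]) (simp add: mult_ac)
  show ?thesis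
    by (simp only: phi_Suc[OF assms] *) (simp only: ext phi_def[of "Suc n"] sum_subtractf sum_distrib_left)
qed

section \<open>The expansions of the products\<close>

definition diag_sum where "diag_sum n x y = (\<Sum>k\<le>n. diag_coeff n k * (qpoch x q k * qpoch y q k))"

text \<open>
This is \<open>1 - (1 - a q\<^sup>k) (1 - x q\<^sup>k) / (1 - c q\<^sup>2\<^sup>k)\<close>, sorted by powers of \<open>x\<close>.
\<close>
definition mixed_factor :: "complex \<Rightarrow> nat \<Rightarrow> complex" where
  "mixed_factor x k = (a * q ^ k - c * q ^ k * q ^ k + q ^ k * (1 - a * q ^ k) * x) / (1 - c * q ^ k * q ^ k)"

definition mixed_sum where
  "mixed_sum n x y = (\<Sum>k\<le>n. mixed_coeff n k * mixed_factor x k * (qpoch x q k * qpoch y q k))"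

lemma mixed_coeff_eq: "(1 - c * q ^ n) * q ^ k * mixed_coeff n k = (1 - c * q ^ n * q ^ k) * diag_coeff n k"
  using qpoch_shift[of "c * q ^ n" q k] by (simp add: diag_coeff_def mixed_coeff_def mult_ac)

lemma mixed_coeff_eq_Suc: "a * (1 - q ^ Suc n) * q ^ k * mixed_coeff n k
    = (q ^ k - q ^ Suc n) * diag_coeff (Suc n) k"
  using qpoch_negpow_Suc_n[of k n] by (simp add: diag_coeff_def mixed_coeff_def mult_ac)

lemma one_minus_c_square_nonzero: "k < N \<Longrightarrow> 1 - c * q ^ k * q ^ k \<noteq> 0"
  using one_minus_pow_nonzero(2)[of "k + k"] by (simp add: power_add mult.assoc)

text \<open>
With \<open>K = q\<^sup>k\<close> and \<open>P = q\<^sup>n\<^sup>+\<^sup>1\<close> all coefficients are multiples of \<open>diag_coeff (Suc n) k\<close>. What remains is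
an identity between two polynomials linear in \<open>x\<close>, after \<open>x y\<close> has been replaced by \<open>c\<close>; thus the
recurrence holds term by term.
\<close>
lemma mixed_sum_recurrence:
  assumes "x * y = c" "Suc n < N"
  shows "(1 - c * q ^ Suc n) * mixed_sum (Suc n) x y
    = (a - c * q ^ Suc n + (1 - a * q ^ Suc n) * x) * diag_sum (Suc n) x y - a * x * (1 - q ^ Suc n)
        * mixed_sum n y x"
proof -
  have Mn: "mixed_sum n y x = (\<Sum>k\<le>Suc n. mixed_coeff n k * mixed_factor y k * (qpoch x q k * qpoch y q k))"
    by (simp add: mixed_sum_def coeff_eq_0 mult_ac)
  have "(1 - c * q ^ Suc n) * (mixed_coeff (Suc n) k * mixed_factor x k * (qpoch x q k * qpoch y q k))
     = (a - c * q ^ Suc n + (1 - a * q ^ Suc n) * x) * (diag_coeff (Suc n) k * (qpoch x q k * qpoch y q k))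
       - a * x * (1 - q ^ Suc n) * (mixed_coeff n k * mixed_factor y k * (qpoch x q k * qpoch y q k))"
           if "k \<le> Suc n" for k
  proof -
    define K where "K = q ^ k" define P where "P = q ^ Suc n"
    have K: "K \<noteq> 0" using q0 by (simp add: K_def)
    have d: "1 - c * K * K \<noteq> 0" using one_minus_c_square_nonzero[of k] that assms by (simp add: K_def)
    have w: "mixed_factor z k = K * (a - c * K + (1 - a * K) * z) / (1 - c * K * K)" for z
      by (simp add: mixed_factor_def K_def algebra_simps)
    have "(1 - c * P * K) * (a - c * K + (1 - a * K) * x)
       = (a - c * P + (1 - a * P) * x) * (1 - c * K * K) - x * (K - P) * (a - c * K + (1 - a * K) * y)"
      unfolding assms(1)[symmetric] by algebra
    moreover have "mixed_factor z k * (1 - c * K * K) = K * (a - c * K + (1 - a * K) * z)" for z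
      using d by (simp add: w)
    note this[of x] this[of y]
    ultimately have "(1 - c * K * K) * ((1 - c * P * K) * mixed_factor x k)
       = (1 - c * K * K) * (K * (a - c * P + (1 - a * P) * x) - x * (K - P) * mixed_factor y k)"
      by algebra
    then have "(1 - c * P * K) * mixed_factor x k
        = K * (a - c * P + (1 - a * P) * x) - x * (K - P) * mixed_factor y k"
      by (rule mult_left_cancel[OF d, THEN iffD1])
    then have "diag_coeff (Suc n) k * ((1 - c * P * K) * mixed_factor x k)
        = diag_coeff (Suc n) k * (K * (a - c * P + (1 - a * P) * x) - x * (K - P) * mixed_factor y k)"
      by (simp only:)
    moreover have "(1 - c * P) * K * mixed_coeff (Suc n) k = (1 - c * P * K) * diag_coeff (Suc n) k"
      using mixed_coeff_eq[of "Suc n" k] by (simp add: K_def P_def)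
    moreover have "a * (1 - P) * K * mixed_coeff n k = (K - P) * diag_coeff (Suc n) k"
      using mixed_coeff_eq_Suc[of n k] by (simp add: K_def P_def)
    ultimately have "K * ((1 - c * P) * mixed_coeff (Suc n) k * mixed_factor x k)
        = K * ((a - c * P + (1 - a * P) * x) * diag_coeff (Suc n) k - x
            * (a * (1 - P) * mixed_coeff n k) * mixed_factor y k)"
      by algebra
    then have "(1 - c * P) * mixed_coeff (Suc n) k * mixed_factor x k
        = (a - c * P + (1 - a * P) * x) * diag_coeff (Suc n) k - x * (a * (1 - P) * mixed_coeff n k)
            * mixed_factor y k"
      by (rule mult_left_cancel[OF K, THEN iffD1])
    from arg_cong[OF this, of "\<lambda>t. t * (qpoch x q k * qpoch y q k)"] show ?thesis
      unfolding P_def by (simp only: left_diff_distrib right_diff_distrib mult_ac)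
  qed
  then show ?thesis
    by (simp only: mixed_sum_def[of "Suc n"] diag_sum_def Mn sum_distrib_left sum_subtractf[symmetric])
       (intro sum.cong, auto)
qed

definition common_ratio where
  "common_ratio k = (1 - a * q ^ k) * (a - c * q ^ k)
     / (a * (1 - q * q ^ k) * (1 - c * q ^ k) * (1 - c * q ^ k * q ^ k) * (1 - c * q * q ^ k * q ^ k))"

lemma common_part_Suc: "common_part (Suc k) = common_part k * common_ratio k"
proof -
  have "q ^ (2 * k) = q ^ k * q ^ k" by (simp add: mult_2 power_add)
  then have "qpoch c q (2 * Suc k) = qpoch c q (2 * k)
      * ((1 - c * q ^ k * q ^ k) * (1 - c * q * q ^ k * q ^ k))"
    by (simp add: qpoch_Suc mult.assoc)
  moreover have "qpoch (c / a) q (Suc k) = qpoch (c / a) q k * ((a - c * q ^ k) / a)"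
    using a0 by (simp add: qpoch_Suc field_simps)
  ultimately show ?thesis
    unfolding common_part_def common_ratio_def by (simp only: qpoch_Suc) (simp add: mult_ac)
qed

lemma diag_coeff_Suc:
  "diag_coeff n (Suc k) = diag_coeff n k * (1 - q ^ k / q ^ n) * (1 - c * q ^ n * q ^ k) * q * common_ratio k"
  by (simp add: diag_coeff_def qpoch_Suc common_part_Suc mult_ac)

text \<open>
This and the next lemma refer to a raised index \<open>Suc k\<close>, so that \<open>diag_coeff\<close> at degrees
\<open>n\<close>, \<open>n + 1\<close> and \<open>n + 2\<close> are all expressed by \<open>diag_coeff (Suc n) k\<close>. With the same \<open>k\<close> on
both sides one would have to divide by \<open>q\<^sup>k - q\<^sup>n\<^sup>+\<^sup>2\<close>, which vanishes at the last index.
\<close>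
lemma diag_coeff_Suc_Suc:
  "(1 - c * q ^ n) * diag_coeff (Suc n) (Suc k)
     = a * diag_coeff n k * (1 - 1 / q ^ Suc n) * (1 - c * q ^ n * q ^ k) * (1 - c * q ^ Suc n * q ^ k)
         * q * common_ratio k"
proof -
  have "(1 - c * q ^ n) * qpoch (c * q ^ Suc n) q (Suc k)
     = qpoch (c * q ^ n) q k * (1 - c * q ^ n * q ^ k) * (1 - c * q ^ Suc n * q ^ k)"
    using qpoch_shift[of "c * q ^ n" q k] by (simp add: qpoch_Suc[of "c * (q * q ^ n)"] mult_ac)
  then have "a * a ^ n * ((1 - 1 / q ^ Suc n) * qpoch (1 / q ^ n) q k)
      * ((1 - c * q ^ n) * qpoch (c * q ^ Suc n) q (Suc k))
      * (common_part k * common_ratio k) * q * q ^ k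
     = a * a ^ n * ((1 - 1 / q ^ Suc n) * qpoch (1 / q ^ n) q k) *
     (qpoch (c * q ^ n) q k * (1 - c * q ^ n * q ^ k) * (1 - c * q ^ Suc n * q ^ k))
         * (common_part k * common_ratio k) * q * q ^ k"
    by (simp only:)
  then show ?thesis unfolding diag_coeff_def qpoch_negpow_Suc_Suc common_part_Suc power_Suc[of a]
      power_Suc[of q k] by (simp only: mult_ac)
qed

lemma diag_coeff_pred:
  "a * (1 - q ^ Suc n) * diag_coeff n (Suc k)
     = diag_coeff (Suc n) k * (q ^ k - q ^ Suc n) * (1 - q ^ k / q ^ n) * (1 - c * q ^ n) * q
         * common_ratio k"
proof -
  have 1: "qpoch (c * q ^ n) q (Suc k) = (1 - c * q ^ n) * qpoch (c * q ^ Suc n) q k"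
    using qpoch_shift[of "c * q ^ n" q k] by (simp add: qpoch_Suc mult_ac)
  have 2: "(1 - q ^ Suc n) * qpoch (1 / q ^ n) q (Suc k)
      = (q ^ k - q ^ Suc n) * qpoch (1 / q ^ Suc n) q k * (1 - q ^ k / q ^ n)"
    by (simp only: qpoch_negpow_Suc_n) (simp add: qpoch_Suc)
  have "a * a ^ n * ((1 - q ^ Suc n) * qpoch (1 / q ^ n) q (Suc k)) * qpoch (c * q ^ n) q (Suc k)
      * (common_part k * common_ratio k) * q * q ^ k
    = a * a ^ n * ((q ^ k - q ^ Suc n) * qpoch (1 / q ^ Suc n) q k * (1 - q ^ k / q ^ n))
        * ((1 - c * q ^ n) * qpoch (c * q ^ Suc n) q k)
      * (common_part k * common_ratio k) * q * q ^ k"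
    by (simp only: 1 2)
  then show ?thesis unfolding diag_coeff_def common_part_Suc power_Suc[of a] power_Suc[of q k]
      by (simp only: mult_ac)
qed

text \<open>
The cancellation of neighbouring terms in \<open>diag_sum_recurrence\<close>, with \<open>P = q\<^sup>n\<^sup>+\<^sup>1\<close>, \<open>K = q\<^sup>k\<close> and the
factors common to all terms removed. The three terms on the left belong to the degrees \<open>n + 2\<close>, \<open>n\<close>
and \<open>n + 1\<close>.
\<close>
lemma telescoping_identity:
  fixes P K :: complex
  assumes "P \<noteq> 0" "K \<noteq> 0"
  shows "(1 - c * P) * ((1 - 1 / (P * q)) * (1 - c * P * K) * (1 - c * P * K * q))
     - c * (1 - P) * ((K - P) * (1 - K * q / P) * (1 - c * P / q))
     - (1 - K / P) * (1 - c * P * K) * (1 - c * (K * q) * (K * q)) * (1 - c * P * P) / (K * q)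
   = - ((1 - c * P * P) * (1 - K * q) * (1 - c * K) * (1 - c * q * K * K) / (K * q))"
  using assms q0 by (simp add: divide_simps) algebra

text \<open>
The left-hand side collects what multiplies \<open>diag_coeff (Suc n) k
    * e\<^sub>k\<close> in \<open>diag_sum_recurrence\<close>. It is symmetric
in \<open>x\<close> and \<open>y\<close>, hence linear in \<open>x + y\<close>, hence a combination of \<open>1\<close> and \<open>(1 - x K) (1 - y K) = e\<^sub>k\<^sub>+\<^sub>1 / e\<^sub>k\<close>.
The gain is that both coefficients factor, and share \<open>1 - c P\<^sup>2\<close>.
\<close>
lemma summand_identity:
  fixes P K x y :: complex
  assumes "x * y = c" "K \<noteq> 0" "1 - c * K * K \<noteq> 0"
  defines "u \<equiv> a - c * P" and "v \<equiv> 1 - a * P"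
  shows "(1 - c * P * K) * ((u + v * x) * (a - c * K + (1 - a * K) * y) + (u + v * y)
      * (a - c * K + (1 - a * K) * x)) / (1 - c * K * K)
     - (u + v * x) * (u + v * y)
   = a * (1 - c * P * P) * (1 - c * K * K) / K
     - (1 - c * P * P) * (1 - a * K) * (a - c * K) * (1 - x * K) * (1 - y * K) / (K * (1 - c * K * K))"
proof -
  have key: "K * ((1 - c * P * K) * ((u + v * x) * (a - c * K + (1 - a * K) * y) + (u + v * y)
      * (a - c * K + (1 - a * K) * x)))
     - K * (1 - c * K * K) * ((u + v * x) * (u + v * y))
   = a * (1 - c * P * P) * (1 - c * K * K) * (1 - c * K * K)
     - (1 - c * P * P) * (1 - a * K) * (a - c * K) * (1 - x * K) * (1 - y * K)"
    unfolding u_def v_def assms(1)[symmetric] by algebra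
  have "X / D - Y = Z / K - W / (K * D)" if "K * X - K * D * Y = Z * D - W" "D \<noteq> 0" for X Y Z W D
    using that assms(2) by (simp add: divide_simps) algebra
  from this[OF key assms(3)] show ?thesis
    by (simp only: mult.assoc)
qed

text \<open>
In terms of \<open>\<phi>\<close> this is the product of the three-term recurrences for \<open>x\<close> and for \<open>y\<close>, as explained
at the beginning. Here \<open>W k * e k - V k * e (Suc k)\<close> is the contribution of the
sums of degree \<open>n + 1\<close>, and \<open>T k\<close> combines its first term with those of degrees \<open>n\<close> and \<open>n + 2\<close>.
\<close>
lemma diag_sum_recurrence:
  assumes "x * y = c" "Suc (Suc n) \<le> N"
  defines "P \<equiv> q ^ Suc n"
  defines "u \<equiv> a - c * P" and "v \<equiv> 1 - a * P"
  shows "(1 - c * P)\<^sup>2 * diag_sum (Suc (Suc n)) x y =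
    (1 - c * P) * ((u + v * x) * mixed_sum (Suc n) y x + (u + v * y) * mixed_sum (Suc n) x y)
    - (u + v * x) * (u + v * y) * diag_sum (Suc n) x y + a\<^sup>2 * c * (1 - P)\<^sup>2 * diag_sum n x y"
proof -
  define e where "e k = qpoch x q k * qpoch y q k" for k
  define W where "W k = a * (1 - c * P * P) * (1 - c * q ^ k * q ^ k) / q ^ k * diag_coeff (Suc n) k" for k
  define T where "T k = (1 - c * P)\<^sup>2 * diag_coeff (Suc (Suc n)) k - a\<^sup>2 * c * (1 - P)\<^sup>2
      * diag_coeff n k - W k" for k
  define V where "V k = (1 - c * P * P) * (1 - a * q ^ k) * (a - c * q ^ k)
      / (q ^ k * (1 - c * q ^ k * q ^ k)) * diag_coeff (Suc n) k" for k
  have "(\<Sum>k\<le>Suc (Suc n). T k * e k + V k * e (Suc k)) = 0"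
  proof (rule sum_telescope_zero)
    show "T 0 = 0" by (simp add: T_def W_def) algebra
    show "V (Suc (Suc n)) = 0" by (simp add: V_def coeff_eq_0)
    fix k assume k: "k < Suc (Suc n)"
    then have kN: "k < N" "k < 2 * N" "Suc (k + k) < 2 * N" using assms by simp_all
    define K where "K = q ^ k"
    define b where "b = diag_coeff (Suc n) k"
    have K: "K \<noteq> 0" and P: "P \<noteq> 0" using q0 by (simp_all add: K_def P_def)
    have d: "1 - K * q \<noteq> 0" "1 - c * K \<noteq> 0" "1 - c * K * K \<noteq> 0"
      using one_minus_pow_nonzero(1)[OF kN(1)] one_minus_pow_nonzero(2)[OF kN(2)]
          one_minus_c_square_nonzero[OF kN(1)] by (simp_all add: K_def mult.commute)
    have d4: "1 - c * q * K * K \<noteq> 0"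
      using one_minus_pow_nonzero(2)[OF kN(3)] by (simp add: K_def power_add mult_ac)
    have rho: "common_ratio k = (1 - a * K) * (a - c * K)
        / (a * (1 - K * q) * (1 - c * K) * (1 - c * K * K) * (1 - c * q * K * K))"
      by (simp add: common_ratio_def K_def mult.commute)
    have Q: "q ^ n = P / q" using q0 by (simp add: P_def)
    have 1: "(1 - c * P) * diag_coeff (Suc (Suc n)) (Suc k)
      = a * b * q * common_ratio k * ((1 - 1 / (P * q)) * (1 - c * P * K) * (1 - c * P * K * q))"
      using diag_coeff_Suc_Suc[of "Suc n" k] by (simp add: P_def K_def b_def mult_ac)
    have 2: "a * (a * (1 - P) * diag_coeff n (Suc k))
        = a * b * q * common_ratio k * ((K - P) * (1 - K * q / P) * (1 - c * P / q))"
      using diag_coeff_pred[of n k] unfolding Q P_def[symmetric] K_def[symmetric] b_def[symmetric]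
          by (simp add: mult_ac)
    have 3: "W (Suc k) = a * b * q * common_ratio k
        * ((1 - K / P) * (1 - c * P * K) * (1 - c * (K * q) * (K * q)) * (1 - c * P * P) / (K * q))"
      unfolding W_def diag_coeff_Suc P_def[symmetric] K_def[symmetric] b_def[symmetric] power_Suc[of q k]
      by (simp add: mult_ac)
    have factor: "p * (s * X) - r * (s * Y) - s * Z = s * (p * X - r * Y - Z)" for p r s X Y Z :: complex
      by algebra
    have "T (Suc k) = (1 - c * P) * ((1 - c * P) * diag_coeff (Suc (Suc n)) (Suc k)) - c * (1 - P)
        * (a * (a * (1 - P) * diag_coeff n (Suc k))) - W (Suc k)"
      unfolding T_def by (simp add: power2_eq_square)
    also have "\<dots> = a * b * q * common_ratio k * (- ((1 - c * P * P) * (1 - K * q) * (1 - c * K)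
        * (1 - c * q * K * K) / (K * q)))"
      unfolding 1 2 3 telescoping_identity[OF P K, symmetric] by (rule factor)
    also have "\<dots> = - V k"
      using q0 a0 K d d4 unfolding V_def rho K_def[symmetric] b_def[symmetric] by (simp add: divide_simps)
    finally show "T (Suc k) = - V k" .
  qed
  moreover have "T k * e k + V k * e (Suc k)
     = (1 - c * P)\<^sup>2 * (diag_coeff (Suc (Suc n)) k * e k) - a\<^sup>2 * c * (1 - P)\<^sup>2 * (diag_coeff n k * e k)
      - ((1 - c * P) * (u + v * x) * (mixed_coeff (Suc n) k * mixed_factor y k * e k) + (1 - c * P)
          * (u + v * y) * (mixed_coeff (Suc n) k * mixed_factor x k * e k)
        - (u + v * x) * (u + v * y) * (diag_coeff (Suc n) k * e k))" if "k \<le> Suc (Suc n)" for k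
  proof (cases "k = Suc (Suc n)")
    \<comment> \<open>Here \<open>1 - c * q ^ k * q ^ k\<close> may vanish, but all terms in which it is a denominator do so too.\<close>
    case True
    then have "diag_coeff (Suc n) k = 0" "mixed_coeff (Suc n) k = 0" by (simp_all add: coeff_eq_0)
    then show ?thesis by (simp add: T_def V_def W_def left_diff_distrib)
  next
    case False
    define K where "K = q ^ k"
    have K: "K \<noteq> 0" using q0 by (simp add: K_def)
    have D: "1 - c * K * K \<noteq> 0" using one_minus_c_square_nonzero[of k] that False assms by (simp add: K_def)
    have CB: "(1 - c * P) * mixed_coeff (Suc n) k = (1 - c * P * K) * diag_coeff (Suc n) k / K"
      using mixed_coeff_eq[of "Suc n" k] K by (simp add: K_def P_def eq_divide_eq mult_ac)
    have w: "mixed_factor z k = K * (a - c * K + (1 - a * K) * z) / (1 - c * K * K)" for z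
      by (simp add: mixed_factor_def K_def algebra_simps)
    have factor: "(g * b / L) * ((p * (L * r / d) + s * (L * t / d)) * f) - p * s * (b * f)
        = b * f * (g * (p * r + s * t) / d - p * s)"
      if "L \<noteq> 0" "d \<noteq> 0" for g b L p r s t d f :: complex
      using that by (simp add: field_simps)
    have expand: "b * f * (s - m * z * w / d) = s * b * f - m / d * b * (z * w * f)"
      for b f s m z w d :: complex
      by (simp add: right_diff_distrib mult_ac)
    have eS: "e (Suc k) = (1 - x * K) * (1 - y * K) * e k" by (simp add: e_def qpoch_Suc K_def mult_ac)
    have "(1 - c * P) * (u + v * x) * (mixed_coeff (Suc n) k * mixed_factor y k * e k) + (1 - c * P)
        * (u + v * y) * (mixed_coeff (Suc n) k * mixed_factor x k * e k)
        - (u + v * x) * (u + v * y) * (diag_coeff (Suc n) k * e k)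
      = ((1 - c * P) * mixed_coeff (Suc n) k) * (((u + v * x) * mixed_factor y k + (u + v * y)
          * mixed_factor x k) * e k) - (u + v * x) * (u + v * y) * (diag_coeff (Suc n) k * e k)"
      by algebra
    also have "\<dots> = diag_coeff (Suc n) k * e k * ((1 - c * P * K)
        * ((u + v * x) * (a - c * K + (1 - a * K) * y) + (u + v * y) * (a - c * K + (1 - a * K) * x))
        / (1 - c * K * K)
     - (u + v * x) * (u + v * y))"
      unfolding CB w using K D by (rule factor)
    also have "\<dots> = W k * e k - V k * e (Suc k)"
      unfolding u_def v_def summand_identity[OF assms(1) K D] W_def V_def eS K_def[symmetric]
      by (rule expand)
    finally show ?thesis by (simp add: T_def algebra_simps)
  qed
  ultimately have "(\<Sum>k\<le>Suc (Suc n). (1 - c * P)\<^sup>2 * (diag_coeff (Suc (Suc n)) k * e k) - a\<^sup>2 * c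
      * (1 - P)\<^sup>2 * (diag_coeff n k * e k)
      - ((1 - c * P) * (u + v * x) * (mixed_coeff (Suc n) k * mixed_factor y k * e k) + (1 - c * P)
          * (u + v * y) * (mixed_coeff (Suc n) k * mixed_factor x k * e k)
        - (u + v * x) * (u + v * y) * (diag_coeff (Suc n) k * e k))) = 0"
    by simp
  moreover have "diag_sum n x y = (\<Sum>k\<le>Suc (Suc n). diag_coeff n k * e k)" "diag_sum (Suc n) x y
      = (\<Sum>k\<le>Suc (Suc n). diag_coeff (Suc n) k * e k)"
    "mixed_sum (Suc n) x y = (\<Sum>k\<le>Suc (Suc n). mixed_coeff (Suc n) k * mixed_factor x k * e k)"
    "mixed_sum (Suc n) y x = (\<Sum>k\<le>Suc (Suc n). mixed_coeff (Suc n) k * mixed_factor y k * e k)"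
    "diag_sum (Suc (Suc n)) x y = (\<Sum>k\<le>Suc (Suc n). diag_coeff (Suc (Suc n)) k * e k)"
    by (simp_all add: diag_sum_def mixed_sum_def e_def coeff_eq_0 mult_ac)
  ultimately show ?thesis
    by (simp only: sum_subtractf sum.distrib sum_distrib_left[symmetric]) algebra
qed

lemma diag_sum_commute: "diag_sum n y x = diag_sum n x y"
  by (simp add: diag_sum_def mult_ac)

lemma phi_0: "phi 0 x = 1" and diag_sum_0: "diag_sum 0 x y = 1" and mixed_sum_0: "mixed_sum 0 x y
    = mixed_factor x 0"
  by (simp_all add: phi_def diag_sum_def mixed_sum_def)

lemma phi_1:
  assumes "0 < N" shows "phi (Suc 0) x = mixed_factor x 0"
  using phi_Suc[of 0 x] assms one_minus_pow_nonzero(2)[of 0] by (simp add: mixed_factor_def field_simps)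

lemma diag_sum_1:
  assumes "x * y = c" "0 < N" shows "diag_sum (Suc 0) x y = mixed_factor x 0 * mixed_factor y 0"
proof -
  have d: "1 - c \<noteq> 0" "1 - c * q \<noteq> 0" "1 - q \<noteq> 0"
      using one_minus_pow_nonzero(2)[of 0] one_minus_pow_nonzero(2)[of 1] one_minus_pow_nonzero(1)[of 0]
      assms by simp_all
  have "qpoch c q 2 = (1 - c) * (1 - c * q)" by (simp add: numeral_2_eq_2 qpoch_Suc)
  moreover have num: "a * ((1 - 1 / q) * ((1 - a) * (1 - c / a))) * q = - ((1 - q) * ((1 - a) * (a - c)))"
    using q0 a0 by (simp add: field_simps)
  ultimately have "diag_coeff (Suc 0) (Suc 0) = - ((1 - a) * (a - c) / ((1 - c) * (1 - c)))"
    using d q0 a0 by (simp add: diag_coeff_def common_part_def qpoch_Suc num)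
  then have "diag_sum (Suc 0) x y = a - (1 - a) * (a - c) / ((1 - c) * (1 - c)) * ((1 - x) * (1 - y))"
    by (simp add: diag_sum_def qpoch_Suc)
  also have "\<dots> = (a - c + (1 - a) * x) * (a - c + (1 - a) * y) / ((1 - c) * (1 - c))"
  proof -
    have "a * ((1 - c) * (1 - c)) - (1 - a) * (a - c) * ((1 - x) * (1 - y))
      = (a - c + (1 - a) * x) * (a - c + (1 - a) * y)"
      unfolding assms(1)[symmetric] by algebra
    with d show ?thesis by (simp add: divide_simps)
  qed
  finally show ?thesis by (simp add: mixed_factor_def)
qed

section \<open>Induction on the degree\<close>

text \<open>
All four products of \<open>\<phi>\<^sub>n, \<phi>\<^sub>n\<^sub>+\<^sub>1\<close> at \<open>x\<close> with the same at \<open>y\<close>: the recurrences have order two, and each of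
them uses the expansions of the other kind.
\<close>
lemma products_of_consecutive_phi:
  assumes "x * y = c"
  shows "Suc n \<le> N \<Longrightarrow> phi n x * phi n y = diag_sum n x y
    \<and> phi (Suc n) x * phi n y = mixed_sum n x y
    \<and> phi n x * phi (Suc n) y = mixed_sum n y x
    \<and> phi (Suc n) x * phi (Suc n) y = diag_sum (Suc n) x y"
proof (induction n)
  case 0
  then show ?case using assms by (simp add: phi_0 diag_sum_0 mixed_sum_0 phi_1 diag_sum_1)
next
  case (Suc n)
  define P where "P = q ^ Suc n"
  have d: "1 - c * P \<noteq> 0" using one_minus_pow_nonzero(2)[of "Suc n"] Suc.prems by (simp add: P_def)
  have N: "Suc n < N" using Suc.prems by simp
  have yx: "y * x = c" using assms by (simp add: mult.commute)
  from Suc have 1: "phi n x * phi n y = diag_sum n x y" "phi (Suc n) x * phi n y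
      = mixed_sum n x y" "phi n x * phi (Suc n) y = mixed_sum n y x"
    "phi (Suc n) x * phi (Suc n) y = diag_sum (Suc n) x y" by simp_all
  note Fx = phi_three_term[OF N, of x, folded P_def]
  note Fy = phi_three_term[OF N, of y, folded P_def]
  note Mx = mixed_sum_recurrence[OF assms N, folded P_def]
  note My = mixed_sum_recurrence[OF yx N, folded P_def, unfolded diag_sum_commute[of _ y x]]
  have 2: "phi (Suc (Suc n)) x * phi (Suc n) y = mixed_sum (Suc n) x y"
  proof (rule mult_left_cancel[OF d, THEN iffD1])
    show "(1 - c * P) * (phi (Suc (Suc n)) x * phi (Suc n) y) = (1 - c * P) * mixed_sum (Suc n) x y"
      using Fx Mx 1 by algebra
  qed
  have 3: "phi (Suc n) x * phi (Suc (Suc n)) y = mixed_sum (Suc n) y x"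
  proof (rule mult_left_cancel[OF d, THEN iffD1])
    show "(1 - c * P) * (phi (Suc n) x * phi (Suc (Suc n)) y) = (1 - c * P) * mixed_sum (Suc n) y x"
      using Fy My 1 by algebra
  qed
  have d2: "(1 - c * P)\<^sup>2 \<noteq> 0" using d by simp
  have 4: "phi (Suc (Suc n)) x * phi (Suc (Suc n)) y = diag_sum (Suc (Suc n)) x y"
  proof (rule mult_left_cancel[OF d2, THEN iffD1])
    define u where "u = a - c * P" define v where "v = 1 - a * P"
    \<comment> \<open>Multiply the two recurrences, each with only its \<open>phi n\<close> term on the right.\<close>
    have "((1 - c * P) * phi (Suc (Suc n)) x - (u + v * x) * phi (Suc n) x)
        * ((1 - c * P) * phi (Suc (Suc n)) y - (u + v * y) * phi (Suc n) y)
      = (a * x * (1 - P) * phi n x) * (a * y * (1 - P) * phi n y)"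
      unfolding Fx Fy u_def v_def by simp
    then have "(1 - c * P)\<^sup>2 * (phi (Suc (Suc n)) x * phi (Suc (Suc n)) y)
      = (1 - c * P) * ((u + v * x) * (phi (Suc n) x * phi (Suc (Suc n)) y) + (u + v * y)
          * (phi (Suc (Suc n)) x * phi (Suc n) y))
      - (u + v * x) * (u + v * y) * (phi (Suc n) x * phi (Suc n) y) + a\<^sup>2 * (x * y) * (1 - P)\<^sup>2
          * (phi n x * phi n y)"
      by algebra
    then show "(1 - c * P)\<^sup>2 * (phi (Suc (Suc n)) x * phi (Suc (Suc n)) y)
        = (1 - c * P)\<^sup>2 * diag_sum (Suc (Suc n)) x y"
      unfolding 1 2 3 assms diag_sum_recurrence[OF assms Suc.prems, folded P_def, folded u_def v_def] .
  qed
  from 1 2 3 4 show ?case by simp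
qed

lemma product_formula:
  assumes "x * y = c" "n \<le> N"
  shows "phi n x * phi n y = diag_sum n x y"
  using products_of_consecutive_phi[OF assms(1), of "n - 1"] assms(2)
  by (cases n) (simp_all add: phi_0 diag_sum_0)

end

theorem theorem1p1:
  fixes n :: nat and q a x c sqrt_c sqrt_q :: complex
  assumes "sqrt_c ^ 2 = c" and "sqrt_q ^ 2 = q"
    and "q \<noteq> 0" and "a \<noteq> 0" and "x \<noteq> 0"
    and "\<And>k. k \<le> n \<Longrightarrow> qpoch q q k \<noteq> 0"
    and "\<And>k. k \<le> n \<Longrightarrow> qpoch c q k \<noteq> 0"
    and "\<And>k. k \<le> n \<Longrightarrow> qpoch sqrt_c q k \<noteq> 0"
    and "\<And>k. k \<le> n \<Longrightarrow> qpoch (- sqrt_c) q k \<noteq> 0"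
    and "\<And>k. k \<le> n \<Longrightarrow> qpoch (sqrt_c * sqrt_q) q k \<noteq> 0"
    and "\<And>k. k \<le> n \<Longrightarrow> qpoch (- (sqrt_c * sqrt_q)) q k \<noteq> 0"
  shows "basic_hyp [q powi (- int n), a, x] [c, 0] q q
         * basic_hyp [q powi (- int n), a, c / x] [c, 0] q q
       = a ^ n * basic_hyp
           [q powi (- int n), c * q ^ n, a, c / a, x, c / x]
           [c, sqrt_c, - sqrt_c, sqrt_c * sqrt_q, - (sqrt_c * sqrt_q)] q q"
proof -
  have lower: "qpoch sqrt_c q k * qpoch (- sqrt_c) q k * qpoch (sqrt_c * sqrt_q) q k
      * qpoch (- (sqrt_c * sqrt_q)) q k
     = qpoch c q (2 * k)" for k
    using assms(1,2) by (rule qpoch_pm_sqrt)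
  have "qpoch c q (2 * n) \<noteq> 0"
    unfolding lower[symmetric] using assms(8-11)[of n] by simp
  then have c_pow: "c * q ^ k \<noteq> 1" if "k < 2 * n" for k
    using that by (auto simp: qpoch_def)
  have q_pow: "q ^ Suc k \<noteq> 1" if "k < n" for k
    using that assms(6)[of n] by (auto simp: qpoch_def)
  interpret phi_product q a c n
    using assms(3,4) q_pow c_pow by unfold_locales
  have neg: "q powi (- int n) = 1 / q ^ n" by (simp add: power_int_minus divide_inverse)
  have phi: "basic_hyp [q powi (- int n), a, z] [c, 0] q q = phi n z" for z
  proof -
    have "qpoch 0 q k = 1" for k by (simp add: qpoch_def)
    then show ?thesis
      by (subst basic_hyp_terminating[of q n])
        (simp_all add: assms phi_def phi_coeff_def basic_hyp_term_def neg mult_ac)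
  qed
  have "a ^ n * basic_hyp [q powi (- int n), c * q ^ n, a, c / a, x, c / x]
           [c, sqrt_c, - sqrt_c, sqrt_c * sqrt_q, - (sqrt_c * sqrt_q)] q q = diag_sum n x (c / x)"
    by (subst basic_hyp_terminating[of q n])
      (simp_all add: assms diag_sum_def diag_coeff_def common_part_def basic_hyp_term_def neg sum_distrib_left
        lower[symmetric, unfolded mult.commute[of 2]] mult_ac)
  then show ?thesis
    unfolding phi using product_formula[of x "c / x" n] assms(5) by simp
qed

end
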